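(* Let $f\colon X\to Y$ be a continuous map between topological spaces which is locally open onto its image. Then there is a factorization $f=p\circ q$ with $q\colon X\to E$ a continuous open surjection and $p\colon E\to Y$ a filtered map, and this factorization is unique up to isomorphism: if $f=p\circ q=p'\circ q'$ are two such factorizations through $E$ and $E'$, there is a homeomorphism $h\colon E\to E'$ with $q'=h\circ q$ and $p=p'\circ h$. Moreover, if $f$ itself is filtered, then every point $x\in X$ has an open neighbourhood which is mapped by $f$ homeomorphically onto a subspace of $Y$.
   Context: A continuous map $f\colon X\to Y$ is locally open onto its image if every $x\in X$ has an open neighbourhood $U$ such that the induced map $U\to f(U)$ is open onto the subspace $f(U)$ of $Y$. For $x\in X$ let $\mathscr U(x)$ be the neighbourhood filter of $x$, and let $f(\mathscr U(x))$ be the filter on $Y$ generated by the sets $f(N)$, $N\in\mathscr U(x)$ (it converges to $f(x)$). A continuous map $f$ is called filtered if it is locally open onto its image and the map $x\mapsto (f(x),f(\mathscr U(x)))$ (from $X$ to the set of pairs consisting of a point of $Y$ and a filter on $Y$ converging to it) is injective. *)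

theory Defs
  imports "HOL-Analysis.Analysis"
begin

definition locally_open_onto_image :: "'a topology \<Rightarrow> 'b topology \<Rightarrow> ('a \<Rightarrow> 'b) \<Rightarrow> bool"
  where "locally_open_onto_image X Y f \<longleftrightarrow>
    continuous_map X Y f \<and>
    (\<forall>x\<in>topspace X. \<exists>U. openin X U \<and> x \<in> U \<and>
       open_map (subtopology X U) (subtopology Y (f ` U)) f)"

text \<open>
  Filters on the space \<open>Y\<close> are represented as filters on the underlying type. The filter
  generated by the sets \<open>f ` N\<close>, for \<open>N\<close> a neighbourhood of \<open>x\<close>, is then
  \<^term>\<open>filtermap f (nhdsin X x)\<close>.
\<close>

definition filtered_map :: "'a topology \<Rightarrow> 'b topology \<Rightarrow> ('a \<Rightarrow> 'b) \<Rightarrow> bool"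
  where "filtered_map X Y f \<longleftrightarrow>
    locally_open_onto_image X Y f \<and>
    inj_on (\<lambda>x. (f x, filtermap f (nhdsin X x))) (topspace X)"

definition filtered_factorization ::
    "'a topology \<Rightarrow> 'b topology \<Rightarrow> ('a \<Rightarrow> 'b) \<Rightarrow> 'e topology \<Rightarrow> ('a \<Rightarrow> 'e) \<Rightarrow> ('e \<Rightarrow> 'b) \<Rightarrow> bool"
  where "filtered_factorization X Y f E q p \<longleftrightarrow>
    continuous_map X E q \<and> open_map X E q \<and> q ` topspace X = topspace E \<and>
    filtered_map E Y p \<and>
    (\<forall>x\<in>topspace X. f x = p (q x))"

end

theory Submission
  imports Defs
begin

text \<open>
  On an open set \<open>U\<close> on which \<open>f\<close> is open onto \<open>f ` U\<close>, the image under \<open>f\<close> of the neighbourhood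
  filter of \<open>x\<close> is the neighbourhood filter of \<open>f x\<close> in the subspace \<open>f ` U\<close>, hence depends on \<open>f x\<close>
  only. So a filtered map is injective on such a \<open>U\<close>. In general, let \<open>E\<close> be the set of pairs
  consisting of \<open>f x\<close> and the image filter at \<open>x\<close>, with the quotient topology. If \<open>x\<close> and \<open>v\<close> have
  the same pair, they have arbitrarily small open neighbourhoods with the same image in \<open>Y\<close> on
  which \<open>f\<close> is open onto that image, so the quotient map is open. In any factorization the fibres
  of \<open>q\<close> are the fibres of \<open>x \<mapsto> (f x, filtermap f (nhdsin X x))\<close>, which gives uniqueness.
\<close>

section \<open>Sets on which a map is open onto its image, and image filters\<close>

definition open_onto_image_on :: "'a topology \<Rightarrow> 'b topology \<Rightarrow> ('a \<Rightarrow> 'b) \<Rightarrow> 'a set \<Rightarrow> bool"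
  where "open_onto_image_on X Y f U \<longleftrightarrow>
    openin X U \<and> open_map (subtopology X U) (subtopology Y (f ` U)) f"

lemma open_onto_image_on_iff:
  "open_onto_image_on X Y f U \<longleftrightarrow>
    openin X U \<and> (\<forall>V. openin X V \<and> V \<subseteq> U \<longrightarrow> openin (subtopology Y (f ` U)) (f ` V))"
  unfolding open_onto_image_on_def open_map_def
  by (auto simp: openin_open_subtopology)

lemma locally_open_onto_image_alt:
  "locally_open_onto_image X Y f \<longleftrightarrow>
    continuous_map X Y f \<and> (\<forall>x\<in>topspace X. \<exists>U. x \<in> U \<and> open_onto_image_on X Y f U)"
  unfolding locally_open_onto_image_def open_onto_image_on_def by blast

text \<open>Since the image of \<open>W\<close> lies in that of \<open>V\<close>, the open set that
  cuts it out of the image of \<open>U\<close> also cuts it out of the image of \<open>V\<close>.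
  This allows such neighbourhoods to be shrunk freely.\<close>

lemma open_onto_image_on_subset:
  assumes "open_onto_image_on X Y f U" "openin X V" "V \<subseteq> U"
  shows "open_onto_image_on X Y f V"
  unfolding open_onto_image_on_iff
proof (intro conjI allI impI)
  fix W assume W: "openin X W \<and> W \<subseteq> V"
  then obtain T where T: "openin Y T" "f ` W = T \<inter> f ` U"
    using assms unfolding open_onto_image_on_iff openin_subtopology by (meson order_trans)
  have "f ` W \<subseteq> f ` V" "f ` V \<subseteq> f ` U" using W assms by auto
  then have "f ` W = T \<inter> f ` V"
    by (metis T(2) inf.absorb1 inf.absorb2 inf.assoc)
  with \<open>openin Y T\<close> show "openin (subtopology Y (f ` V)) (f ` W)"
    unfolding openin_subtopology by blast
qed (use assms in auto)

text \<open>Openness on \<open>U\<close> turns images of small neighbourhoods of \<open>x\<close>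
  into neighbourhoods of \<open>f x\<close> in the image of \<open>U\<close>; continuity pulls the
  latter back. The right-hand side depends on \<open>x\<close> only through
  \<open>f x\<close>.\<close>

lemma filtermap_nhdsin_open_onto_image_on:
  assumes "continuous_map X Y f" "open_onto_image_on X Y f U" "x \<in> U"
  shows "filtermap f (nhdsin X x) = nhdsin (subtopology Y (f ` U)) (f x)"
proof -
  have U: "openin X U" and op: "\<And>V. openin X V \<Longrightarrow> V \<subseteq> U \<Longrightarrow> openin (subtopology Y (f ` U)) (f ` V)"
    using assms by (auto simp: open_onto_image_on_iff)
  have x: "x \<in> topspace X" using U \<open>x \<in> U\<close> openin_subset by blast
  then have fx: "f x \<in> topspace (subtopology Y (f ` U))"
    using assms continuous_map_image_subset_topspace by fastforce
  have "eventually P (filtermap f (nhdsin X x)) \<longleftrightarrow>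
      eventually P (nhdsin (subtopology Y (f ` U)) (f x))" for P
  proof
    assume "eventually P (filtermap f (nhdsin X x))"
    then obtain S where S: "openin X S" "x \<in> S" "\<forall>z\<in>S. P (f z)"
      using x by (auto simp: eventually_filtermap eventually_nhdsin)
    have "openin (subtopology Y (f ` U)) (f ` (S \<inter> U))"
      using S U by (intro op) auto
    then show "eventually P (nhdsin (subtopology Y (f ` U)) (f x))"
      unfolding eventually_nhdsin using S \<open>x \<in> U\<close>
      by (intro disjI2 exI[of _ "f ` (S \<inter> U)"]) auto
  next
    assume "eventually P (nhdsin (subtopology Y (f ` U)) (f x))"
    then obtain T where T: "openin Y T" "f x \<in> T" "\<forall>y\<in>T \<inter> f ` U. P y"
      using fx unfolding eventually_nhdsin openin_subtopology by blast
    have "openin X ({z \<in> topspace X. f z \<in> T} \<inter> U)"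
      using assms(1) T U openin_continuous_map_preimage by blast
    then show "eventually P (filtermap f (nhdsin X x))"
      unfolding eventually_filtermap eventually_nhdsin using T x \<open>x \<in> U\<close>
      by (intro disjI2 exI[of _ "{z \<in> topspace X. f z \<in> T} \<inter> U"]) auto
  qed
  then show ?thesis by (simp add: filter_eq_iff)
qed

lemma filtermap_nhdsin_open_surjection:
  assumes "continuous_map X E q" "open_map X E q" "q ` topspace X = topspace E" "x \<in> topspace X"
  shows "filtermap q (nhdsin X x) = nhdsin E (q x)"
proof -
  \<comment> \<open>The whole space serves as \<open>U\<close>: by surjectivity its image is all of
    \<open>E\<close>.\<close>
  have "open_onto_image_on X E q (topspace X)"
    unfolding open_onto_image_on_def by (simp add: assms)
  from filtermap_nhdsin_open_onto_image_on[OF assms(1) this assms(4)] show ?thesis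
    by (simp add: assms)
qed

text \<open>Taking image filters respects composition, and the open surjection \<open>q\<close>
  carries the neighbourhood filter of \<open>x\<close> to that of \<open>q x\<close>.\<close>

lemma filtermap_nhdsin_factor:
  assumes "continuous_map X E q" "open_map X E q" "q ` topspace X = topspace E"
    and "\<And>x. x \<in> topspace X \<Longrightarrow> f x = p (q x)" and x: "x \<in> topspace X"
  shows "filtermap p (nhdsin E (q x)) = filtermap f (nhdsin X x)"
proof -
  \<comment> \<open>The equation between \<open>f\<close> and the composite is known only on
    \<open>topspace X\<close>; as this set belongs to the filter, that suffices.\<close>
  have "eventually (\<lambda>z. z \<in> topspace X) (nhdsin X x)"
    unfolding eventually_nhdsin by (intro disjI2 exI[of _ "topspace X"]) (use x in auto)
  then have "filtermap f (nhdsin X x) = filtermap (\<lambda>z. p (q z)) (nhdsin X x)"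
    unfolding filter_eq_iff eventually_filtermap
    by (auto elim: eventually_elim2 simp: assms(4))
  then show ?thesis
    by (simp add: filtermap_nhdsin_open_surjection[OF assms(1-3) x, symmetric] filtermap_filtermap)
qed

text \<open>Equality of the image filters is used twice: first to find \<open>N\<close> with image
  inside that of \<open>V\<close>, then \<open>M\<close> with image inside that of \<open>N\<close>.
  A final cut makes the images equal.\<close>

lemma common_image_neighbourhoods:
  assumes f: "continuous_map X Y f"
    and U: "open_onto_image_on X Y f U" "x \<in> U"
    and V: "open_onto_image_on X Y f V" "v \<in> V"
    and eq: "f x = f v" "filtermap f (nhdsin X x) = filtermap f (nhdsin X v)"
  obtains N M where "openin X N" "x \<in> N" "N \<subseteq> U" "openin X M" "v \<in> M" "M \<subseteq> V" "f ` N = f ` M"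
proof -
  have oU: "openin X U" and oV: "openin X V" using U V by (auto simp: open_onto_image_on_def)
  have x: "x \<in> topspace X" and v: "v \<in> topspace X"
    using U V oU oV openin_subset by blast+
  have "eventually (\<lambda>y. y \<in> f ` V) (filtermap f (nhdsin X v))"
    unfolding eventually_filtermap eventually_nhdsin using oV V by blast
  then obtain S where S: "openin X S" "x \<in> S" "f ` S \<subseteq> f ` V"
    unfolding eq(2)[symmetric] eventually_filtermap eventually_nhdsin using x by blast
  define N where "N = S \<inter> U"
  have N: "openin X N" "x \<in> N" "N \<subseteq> U" "f ` N \<subseteq> f ` V"
    using S U oU by (auto simp: N_def)
  have "eventually (\<lambda>y. y \<in> f ` N) (filtermap f (nhdsin X x))"
    unfolding eventually_filtermap eventually_nhdsin using N by blast
  then obtain T where T: "openin X T" "v \<in> T" "f ` T \<subseteq> f ` N"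
    unfolding eq(2) eventually_filtermap eventually_nhdsin using v by blast
  define M where "M = T \<inter> V"
  have M: "openin X M" "v \<in> M" "M \<subseteq> V" "f ` M \<subseteq> f ` N"
    using T V oV by (auto simp: M_def)
  then obtain W where W: "openin Y W" "f ` M = W \<inter> f ` V"
    using V unfolding open_onto_image_on_iff openin_subtopology by blast
  \<comment> \<open>The image of \<open>M\<close> is the trace of \<open>W\<close> on the image of
    \<open>V\<close>, which contains the image of \<open>N\<close>. Keeping only the points of
    \<open>N\<close> sent into \<open>W\<close> therefore leaves exactly the image of
    \<open>M\<close>.\<close>
  define N' where "N' = {z \<in> topspace X. f z \<in> W} \<inter> N"
  have "openin X N'"
    unfolding N'_def using openin_continuous_map_preimage[OF f W(1)] N(1) by (rule openin_Int)
  moreover have "f ` N' = f ` M"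
  proof
    show "f ` N' \<subseteq> f ` M" unfolding W(2) using N(4) by (auto simp: N'_def)
    show "f ` M \<subseteq> f ` N'"
    proof
      fix y assume y: "y \<in> f ` M"
      then obtain z where "z \<in> N" "y = f z" using M(4) by blast
      moreover have "y \<in> W" using y W(2) by simp
      ultimately show "y \<in> f ` N'" using openin_subset[OF N(1)] by (auto simp: N'_def)
    qed
  qed
  moreover have "f v \<in> W" using imageI[OF M(2), of f] unfolding W(2) by simp
  then have "x \<in> N'" using x N(2) eq(1) by (simp add: N'_def)
  ultimately show ?thesis
    using that[of N' M] M(1-3) N(3) by (simp add: N'_def le_infI2)
qed

section \<open>Pairs of value and image filter, and the quotient by them\<close>

definition filter_germ :: "'a topology \<Rightarrow> ('a \<Rightarrow> 'b) \<Rightarrow> 'a \<Rightarrow> 'b \<times> 'b filter"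
  where "filter_germ X f x = (f x, filtermap f (nhdsin X x))"

text \<open>Openness of these saturations is exactly what makes the quotient map open.\<close>

lemma openin_filter_germ_saturation:
  assumes f: "locally_open_onto_image X Y f" and V: "openin X V"
  shows "openin X {x \<in> topspace X. filter_germ X f x \<in> filter_germ X f ` V}"
proof (subst openin_subopen, intro ballI)
  have cf: "continuous_map X Y f" using f by (simp add: locally_open_onto_image_def)
  fix x assume "x \<in> {x \<in> topspace X. filter_germ X f x \<in> filter_germ X f ` V}"
  then obtain v where x: "x \<in> topspace X" and v: "v \<in> V" "filter_germ X f x = filter_germ X f v"
    by auto
  obtain A where A: "x \<in> A" "open_onto_image_on X Y f A"
    using f x unfolding locally_open_onto_image_alt by blast
  obtain B where B: "v \<in> B" "open_onto_image_on X Y f B"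
    using f v(1) openin_subset[OF V] unfolding locally_open_onto_image_alt by blast
  \<comment> \<open>Intersecting with \<open>V\<close> forces the neighbourhood \<open>M\<close> of
    \<open>v\<close> found below to lie in \<open>V\<close>.\<close>
  have BV: "open_onto_image_on X Y f (B \<inter> V)"
    using B V by (intro open_onto_image_on_subset[OF B(2)]) (auto simp: open_onto_image_on_def)
  obtain N M where NM: "openin X N" "x \<in> N" "N \<subseteq> A" "openin X M" "v \<in> M" "M \<subseteq> B \<inter> V"
      "f ` N = f ` M"
    using common_image_neighbourhoods[OF cf A(2,1) BV, of v] B v unfolding filter_germ_def by auto
  have gN: "open_onto_image_on X Y f N" and gM: "open_onto_image_on X Y f M"
    using open_onto_image_on_subset[OF A(2)] open_onto_image_on_subset[OF BV] NM by auto
  \<comment> \<open>Take \<open>m\<close> in \<open>M\<close> with the same value as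
    \<open>z\<close>. Both image filters are the neighbourhood filter of this value in the common
    image of \<open>N\<close> and \<open>M\<close>, so the germs agree.\<close>
  have "filter_germ X f z \<in> filter_germ X f ` V" if z: "z \<in> N" for z
  proof -
    obtain m where "m \<in> M" "f z = f m" using imageI[OF z, of f] unfolding NM(7) by blast
    then have "filter_germ X f z = filter_germ X f m"
      using filtermap_nhdsin_open_onto_image_on[OF cf gN that]
        filtermap_nhdsin_open_onto_image_on[OF cf gM \<open>m \<in> M\<close>] NM(7)
      by (simp add: filter_germ_def)
    then show ?thesis using \<open>m \<in> M\<close> NM by auto
  qed
  then show "\<exists>T. openin X T \<and> x \<in> T \<and>
      T \<subseteq> {x \<in> topspace X. filter_germ X f x \<in> filter_germ X f ` V}"
    using NM openin_subset by (intro exI[of _ N]) blast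
qed

text \<open>The bound on \<open>W\<close> makes the image of \<open>q\<close>, rather than the whole
  type, the underlying space.\<close>

definition quotient_topology :: "'a topology \<Rightarrow> ('a \<Rightarrow> 'e) \<Rightarrow> 'e topology"
  where "quotient_topology X q =
    topology (\<lambda>W. W \<subseteq> q ` topspace X \<and> openin X {x \<in> topspace X. q x \<in> W})"

lemma openin_quotient_topology:
  "openin (quotient_topology X q) W \<longleftrightarrow>
    W \<subseteq> q ` topspace X \<and> openin X {x \<in> topspace X. q x \<in> W}"
proof -
  have "istopology (\<lambda>W. W \<subseteq> q ` topspace X \<and> openin X {x \<in> topspace X. q x \<in> W})"
    unfolding istopology_def
  proof (intro conjI allI impI)
    fix S T
    assume "S \<subseteq> q ` topspace X \<and> openin X {x \<in> topspace X. q x \<in> S}"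
      and "T \<subseteq> q ` topspace X \<and> openin X {x \<in> topspace X. q x \<in> T}"
    moreover have "{x \<in> topspace X. q x \<in> S \<inter> T} =
        {x \<in> topspace X. q x \<in> S} \<inter> {x \<in> topspace X. q x \<in> T}" by auto
    ultimately show "S \<inter> T \<subseteq> q ` topspace X" "openin X {x \<in> topspace X. q x \<in> S \<inter> T}"
      by auto
  next
    fix K assume "\<forall>S\<in>K. S \<subseteq> q ` topspace X \<and> openin X {x \<in> topspace X. q x \<in> S}"
    moreover have "{x \<in> topspace X. q x \<in> \<Union>K} = (\<Union>S\<in>K. {x \<in> topspace X. q x \<in> S})" by auto
    ultimately show "\<Union>K \<subseteq> q ` topspace X" "openin X {x \<in> topspace X. q x \<in> \<Union>K}"
      by auto
  qed
  then show ?thesis unfolding quotient_topology_def by (simp add: topology_inverse')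
qed

lemma topspace_quotient_topology: "topspace (quotient_topology X q) = q ` topspace X"
proof
  show "topspace (quotient_topology X q) \<subseteq> q ` topspace X"
    using openin_topspace openin_quotient_topology by metis
  have "{x \<in> topspace X. q x \<in> q ` topspace X} = topspace X" by auto
  then have "openin (quotient_topology X q) (q ` topspace X)"
    by (simp add: openin_quotient_topology)
  then show "q ` topspace X \<subseteq> topspace (quotient_topology X q)" by (rule openin_subset)
qed

lemma quotient_map_quotient_topology: "quotient_map X (quotient_topology X q) q"
  unfolding quotient_map_def by (simp add: topspace_quotient_topology openin_quotient_topology)

section \<open>Existence of the factorization\<close>

lemma filtered_factorization_filter_germ:
  assumes f: "locally_open_onto_image X Y f"
  shows "filtered_factorization X Y f (quotient_topology X (filter_germ X f)) (filter_germ X f) fst"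
proof -
  let ?q = "filter_germ X f" and ?E = "quotient_topology X (filter_germ X f)"
  have cf: "continuous_map X Y f" using f by (simp add: locally_open_onto_image_def)
  have quot: "quotient_map X ?E ?q" by (rule quotient_map_quotient_topology)
  have cq: "continuous_map X ?E ?q" using quot by (rule quotient_imp_continuous_map)
  have oq: "open_map X ?E ?q"
    unfolding open_map_def openin_quotient_topology
    using openin_filter_germ_saturation[OF f] openin_subset by blast
  have sq: "?q ` topspace X = topspace ?E" by (simp add: topspace_quotient_topology)
  have pq: "f x = fst (?q x)" for x by (simp add: filter_germ_def)
  \<comment> \<open>Continuity of \<open>fst\<close> on the quotient can be tested after composing
    with the quotient map.\<close>
  have "f = fst \<circ> ?q" by (auto simp: pq)
  then have cp: "continuous_map ?E Y fst"
    using cf continuous_compose_quotient_map[OF quot] by metis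
  have "\<exists>U. e \<in> U \<and> open_onto_image_on ?E Y fst U" if e: "e \<in> topspace ?E" for e
  proof -
    obtain x where x: "x \<in> topspace X" "e = ?q x" using e unfolding sq[symmetric] by blast
    obtain U where U: "x \<in> U" "open_onto_image_on X Y f U"
      using f x unfolding locally_open_onto_image_alt by blast
    have oU: "openin X U" using U by (simp add: open_onto_image_on_def)
    have im: "fst ` ?q ` U = f ` U" by (simp add: image_image pq[symmetric])
    have "open_onto_image_on ?E Y fst (?q ` U)"
      unfolding open_onto_image_on_iff im
    proof (intro conjI allI impI)
      show "openin ?E (?q ` U)" using oq oU by (auto simp: open_map_def)
      fix W assume W: "openin ?E W \<and> W \<subseteq> ?q ` U"
      define V where "V = {x \<in> topspace X. ?q x \<in> W} \<inter> U"
      have "openin X V" using W oU by (auto simp: V_def openin_quotient_topology)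
      then have "openin (subtopology Y (f ` U)) (f ` V)"
        using U by (auto simp: open_onto_image_on_iff V_def)
      \<comment> \<open>Each point of \<open>W\<close> comes from some point of \<open>U\<close>,
        which then lies in \<open>V\<close>.\<close>
      moreover have "?q ` V = W"
        using W openin_subset[OF oU] unfolding V_def by blast
      then have "fst ` W = f ` V" by (metis (no_types, lifting) image_cong image_image pq)
      ultimately show "openin (subtopology Y (f ` U)) (fst ` W)" by simp
    qed
    then show ?thesis using U x by blast
  qed
  then have lp: "locally_open_onto_image ?E Y fst"
    using cp by (simp add: locally_open_onto_image_alt)
  \<comment> \<open>A point of \<open>?E\<close> is itself a value with a filter, and
    \<open>fst\<close> recovers both: the map required to be injective is the identity.\<close>
  have "(fst e, filtermap fst (nhdsin ?E e)) = e" if e: "e \<in> topspace ?E" for e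
  proof -
    obtain x where x: "x \<in> topspace X" "e = ?q x" using e unfolding sq[symmetric] by blast
    have "filtermap fst (nhdsin ?E (?q x)) = filtermap f (nhdsin X x)"
      using filtermap_nhdsin_factor[where f=f and p=fst, OF cq oq sq pq x(1)] .
    then show ?thesis using x by (simp add: filter_germ_def)
  qed
  then have "inj_on (\<lambda>e. (fst e, filtermap fst (nhdsin ?E e))) (topspace ?E)"
    by (metis (no_types, lifting) inj_onI)
  then show ?thesis
    unfolding filtered_factorization_def filtered_map_def using cq oq sq lp pq by blast
qed

section \<open>Uniqueness of the factorization\<close>

lemma filtered_factorization_eq_iff:
  assumes "filtered_factorization X Y f E q p" and x: "x \<in> topspace X" and z: "z \<in> topspace X"
  shows "q x = q z \<longleftrightarrow> filter_germ X f x = filter_germ X f z"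
proof -
  have q: "continuous_map X E q" "open_map X E q" "q ` topspace X = topspace E"
    and pq: "\<And>x. x \<in> topspace X \<Longrightarrow> f x = p (q x)"
    and inj: "inj_on (\<lambda>e. (p e, filtermap p (nhdsin E e))) (topspace E)"
    using assms(1) by (auto simp: filtered_factorization_def filtered_map_def)
  \<comment> \<open>The germ of \<open>f\<close> at \<open>y\<close> is the pair attached to
    \<open>p\<close> at \<open>q y\<close>, and \<open>p\<close> being filtered means that this pair
    determines \<open>q y\<close>.\<close>
  have "filter_germ X f y = (p (q y), filtermap p (nhdsin E (q y)))" if "y \<in> topspace X" for y
    using filtermap_nhdsin_factor[where f=f and p=p, OF q pq that] pq[OF that] by (simp add: filter_germ_def)
  moreover have "q x \<in> topspace E" "q z \<in> topspace E" using q(3) x z by auto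
  ultimately show ?thesis using inj_on_eq_iff[OF inj] x z by simp
qed

text \<open>Continuous open surjections are quotient maps, and \<open>q\<close> and
  \<open>q'\<close> have the same fibres, so each descends along the other.\<close>

lemma filtered_factorization_unique:
  assumes F: "filtered_factorization X Y f E q p" and F': "filtered_factorization X Y f E' q' p'"
  shows "\<exists>h. homeomorphic_map E E' h \<and> (\<forall>x\<in>topspace X. q' x = h (q x)) \<and>
    (\<forall>e\<in>topspace E. p e = p' (h e))"
proof -
  have quot: "quotient_map X E q" "quotient_map X E' q'"
    using F F' by (auto simp: filtered_factorization_def intro: continuous_open_imp_quotient_map)
  have c: "continuous_map X E q" "continuous_map X E' q'"
    and s: "q ` topspace X = topspace E" "q' ` topspace X = topspace E'"
    using F F' by (auto simp: filtered_factorization_def)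
  have eq: "q x = q z \<longleftrightarrow> q' x = q' z" if "x \<in> topspace X" "z \<in> topspace X" for x z
    using filtered_factorization_eq_iff[OF F that] filtered_factorization_eq_iff[OF F' that] by simp
  obtain h where h: "continuous_map E E' h" "\<And>x. x \<in> topspace X \<Longrightarrow> h (q x) = q' x"
    using quotient_map_lift_exists[OF quot(1) c(2)] eq by metis
  obtain k where k: "continuous_map E' E k" "\<And>x. x \<in> topspace X \<Longrightarrow> k (q' x) = q x"
    using quotient_map_lift_exists[OF quot(2) c(1)] eq by metis
  \<comment> \<open>The maps are mutually inverse on the images of \<open>q\<close> and
    \<open>q'\<close>, which are the whole spaces.\<close>
  have "homeomorphic_maps E E' h k"
    unfolding homeomorphic_maps_def using h k by (auto simp flip: s)
  then have "homeomorphic_map E E' h" using homeomorphic_maps_map by blast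
  moreover have "p e = p' (h e)" if e: "e \<in> topspace E" for e
  proof -
    obtain x where "x \<in> topspace X" "e = q x" using e unfolding s(1)[symmetric] by blast
    then show ?thesis using h F F' by (auto simp: filtered_factorization_def)
  qed
  ultimately show ?thesis using h by metis
qed

section \<open>Local behaviour of filtered maps\<close>

lemma filtered_map_imp_local_homeomorphism_onto_image:
  assumes f: "filtered_map X Y f" and x: "x \<in> topspace X"
  shows "\<exists>U. openin X U \<and> x \<in> U \<and> homeomorphic_map (subtopology X U) (subtopology Y (f ` U)) f"
proof -
  have cf: "continuous_map X Y f"
    and inj: "inj_on (\<lambda>x. (f x, filtermap f (nhdsin X x))) (topspace X)"
    using f by (auto simp: filtered_map_def locally_open_onto_image_def)
  obtain U where U: "x \<in> U" "open_onto_image_on X Y f U"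
    using f x unfolding filtered_map_def locally_open_onto_image_alt by blast
  have oU: "openin X U" and om: "open_map (subtopology X U) (subtopology Y (f ` U)) f"
    using U by (auto simp: open_onto_image_on_def)
  have sub: "U \<subseteq> topspace X" "f ` U \<subseteq> topspace Y"
    using openin_subset[OF oU] continuous_map_image_subset_topspace[OF cf] by auto
  \<comment> \<open>On \<open>U\<close> equal values force equal image filters, so injectivity on
    pairs becomes injectivity of \<open>f\<close>.\<close>
  have "inj_on f U"
  proof (rule inj_onI)
    fix a b assume ab: "a \<in> U" "b \<in> U" "f a = f b"
    then have "filtermap f (nhdsin X a) = filtermap f (nhdsin X b)"
      using filtermap_nhdsin_open_onto_image_on[OF cf U(2)] by simp
    then show "a = b" using inj_onD[OF inj] ab sub by blast
  qed
  moreover have "continuous_map (subtopology X U) (subtopology Y (f ` U)) f"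
    using cf by (auto simp: continuous_map_in_subtopology continuous_map_from_subtopology)
  ultimately have "homeomorphic_map (subtopology X U) (subtopology Y (f ` U)) f"
    using om sub by (intro bijective_open_imp_homeomorphic_map) (auto simp: inf.absorb2)
  then show ?thesis using oU U by blast
qed

theorem proposition5:
  fixes X :: "'a topology" and Y :: "'b topology" and f :: "'a \<Rightarrow> 'b"
  assumes "locally_open_onto_image X Y f"
  shows "(\<exists>(E :: ('b \<times> 'b filter) topology) q p. filtered_factorization X Y f E q p) \<and>
    (\<forall>(E :: 'c topology) q p (E' :: 'd topology) q' p'.
       filtered_factorization X Y f E q p \<and> filtered_factorization X Y f E' q' p' \<longrightarrow>
       (\<exists>h. homeomorphic_map E E' h \<and>
            (\<forall>x\<in>topspace X. q' x = h (q x)) \<and>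
            (\<forall>e\<in>topspace E. p e = p' (h e)))) \<and>
    (filtered_map X Y f \<longrightarrow>
       (\<forall>x\<in>topspace X. \<exists>U. openin X U \<and> x \<in> U \<and>
          homeomorphic_map (subtopology X U) (subtopology Y (f ` U)) f))"
proof (intro conjI allI impI ballI)
  show "\<exists>(E :: ('b \<times> 'b filter) topology) q p. filtered_factorization X Y f E q p"
    by (intro exI) (rule filtered_factorization_filter_germ[OF assms])
next
  fix E :: "'c topology" and q p and E' :: "'d topology" and q' p'
  assume "filtered_factorization X Y f E q p \<and> filtered_factorization X Y f E' q' p'"
  then show "\<exists>h. homeomorphic_map E E' h \<and> (\<forall>x\<in>topspace X. q' x = h (q x)) \<and>
      (\<forall>e\<in>topspace E. p e = p' (h e))"
    by (elim conjE) (rule filtered_factorization_unique)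
qed (rule filtered_map_imp_local_homeomorphism_onto_image)

end
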